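(* Let $\mu^{(n)} = B_1^{s^{(n)}}$, $n \in \mathbb{N} \cup \{\infty\}$, be (centred) Besov-1 measures on $\mathbb{R}^{\mathbb{N}}$ whose smoothness parameters satisfy $s^{(n)} \to s^{(\infty)}$ as $n \to \infty$. Then there exists $n_0 \in \mathbb{N}$ such that, for each $n \geq n_0$, $\mu^{(n)}(\ell^1_{\delta^{(\infty)}}) = 1$, and we therefore consider these measures on $X = \ell^1_{\delta^{(\infty)}}$ (after dropping the first $n_0 - 1$ measures). Then, for the Onsager--Machlup functionals $I_{\mu^{(n)}} \colon X \to \overline{\mathbb{R}}$, $n \in \{n' \in \mathbb{N} : n' \geq n_0\} \cup \{\infty\}$, given by $I_{\mu^{(n)}}(u) = \|u\|_{\ell^1_{\gamma^{(n)}}}$ for $u \in \ell^1_{\gamma^{(n)}}$ and $I_{\mu^{(n)}}(u) = +\infty$ otherwise, the sequence $(I_{\mu^{(n)}})_{n \geq n_0}$ is equicoercive and $I_{\mu^{(\infty)}} = \Gamma\text{-}\lim_{n \to \infty} I_{\mu^{(n)}}$.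
   Context: Weighted sequence spaces: for $\gamma = (\gamma_k)_{k \in \mathbb{N}}$ with $\gamma_k > 0$, $\ell^1_\gamma = \{h \in \mathbb{R}^{\mathbb{N}} : (h_k/\gamma_k)_k \in \ell^1\}$ with norm $\|h\|_{\ell^1_\gamma} = \sum_{k} |h_k|/\gamma_k$. $\overline{\mathbb{R}} = \mathbb{R} \cup \{\pm\infty\}$; $\mathbb{N} = \{1,2,\dots\}$. Besov-1 measures: fix a "spatial dimension" $d \in \mathbb{N}$. For $s \in \mathbb{R}$ with $\tau = (s/d + 1/2)^{-1} > 0$ and $\eta > 0$, set $t = s - d(1+\eta)$, $\gamma_k = k^{1 - 1/\tau} = k^{\frac12 - \frac{s}{d}}$ and $\delta_k = k^{2 + \eta - 1/\tau} = k^{\frac32 + \eta - \frac{s}{d}}$. Let $\mu_k$ be the probability measure on $\mathbb{R}$ with Lebesgue density $u \mapsto \frac{1}{2\gamma_k} \exp(-|u/\gamma_k|)$. The (sequence space) Besov measure $B_1^s$ is the product measure $\bigotimes_{k \in \mathbb{N}} \mu_k$ on $\mathbb{R}^{\mathbb{N}}$; it satisfies $B_1^s(\ell^1_\delta) = 1$. The corresponding Besov space is $X_1^s = \ell^1_\gamma$, and $X_1^t = \ell^1_\delta$. In the claim, $d$ is the same for all $n$; $s^{(n)}/d + 1/2 > 0$ for all $n \in \mathbb{N} \cup \{\infty\}$; $\gamma^{(n)}_k = k^{\frac12 - \frac{s^{(n)}}{d}}$; $\eta^{(\infty)} > 0$ is a fixed number; and $\delta^{(\infty)}_k = k^{\frac32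 + \eta^{(\infty)} - \frac{s^{(\infty)}}{d}}$. The space $X = \ell^1_{\delta^{(\infty)}} = X_1^{t^{(\infty)}}$ carries its norm metric. $\Gamma$-convergence: functions $F_n \colon X \to \overline{\mathbb{R}}$ $\Gamma$-converge to $F \colon X \to \overline{\mathbb{R}}$, written $F = \Gamma\text{-}\lim_{n\to\infty} F_n$, if for every $x \in X$: (i) for every sequence $x_n \to x$ in $X$, $F(x) \leq \liminf_{n} F_n(x_n)$; and (ii) there exists a sequence $x_n \to x$ in $X$ with $F(x) \geq \limsup_{n} F_n(x_n)$. Equicoercivity: a sequence $(F_n)$ is equicoercive if for all $\theta \in \mathbb{R}$ there is a compact $K_\theta \subseteq X$ such that $F_n^{-1}([-\infty, \theta]) \subseteq K_\theta$ for all $n$. *)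

theory Defs
  imports "HOL-Probability.Probability" "HOL-Library.Extended_Nat"
begin

text \<open>Real sequences are functions of type \<^typ>\<open>nat \<Rightarrow> real\<close>. In the source sequences are
  indexed from 1; here index \<open>k\<close> stands for the source's index \<open>k + 1\<close>, hence the occurrences
  of \<^term>\<open>Suc k\<close> in the Besov weights below.\<close>

definition ell1 :: "(nat \<Rightarrow> real) \<Rightarrow> (nat \<Rightarrow> real) set" where
  "ell1 w = {h. (\<lambda>k. \<bar>h k / w k\<bar>) summable_on UNIV}"

definition ell1_norm :: "(nat \<Rightarrow> real) \<Rightarrow> (nat \<Rightarrow> real) \<Rightarrow> real" where
  "ell1_norm w h = (\<Sum>\<^sub>\<infinity>k. \<bar>h k\<bar> / w k)"

definition ell1_dist :: "(nat \<Rightarrow> real) \<Rightarrow> (nat \<Rightarrow> real) \<Rightarrow> (nat \<Rightarrow> real) \<Rightarrow> real" where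
  "ell1_dist w x y = ell1_norm w (\<lambda>k. x k - y k)"

text \<open>The norm topology on the carrier \<^term>\<open>ell1 w\<close>. It is meaningful for positive weights
  only, for which \<^term>\<open>ell1_dist w\<close> is a metric on \<^term>\<open>ell1 w\<close> (lemma \<open>Metric_space_ell1\<close>).\<close>

definition ell1_topology :: "(nat \<Rightarrow> real) \<Rightarrow> (nat \<Rightarrow> real) topology" where
  "ell1_topology w = Metric_space.mtopology (ell1 w) (ell1_dist w)"

lemma ell1_summable:
  assumes "\<And>k. w k > 0" "h \<in> ell1 w"
  shows "(\<lambda>k. \<bar>h k\<bar> / w k) summable_on UNIV"
proof -
  have "\<And>k. \<bar>w k\<bar> = w k" using assms(1) by (simp add: less_imp_le)
  then show ?thesis using assms(2) by (simp add: ell1_def abs_divide)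
qed

lemma ell1_diff_summable:
  assumes w: "\<And>k. w k > 0" and "x \<in> ell1 w" "y \<in> ell1 w"
  shows "(\<lambda>k. \<bar>x k - y k\<bar> / w k) summable_on UNIV"
proof (rule summable_on_comparison_test)
  show "(\<lambda>k. \<bar>x k\<bar> / w k + \<bar>y k\<bar> / w k) summable_on UNIV"
    using assms by (intro summable_on_add ell1_summable)
  show "\<bar>x k - y k\<bar> / w k \<le> \<bar>x k\<bar> / w k + \<bar>y k\<bar> / w k" for k
    using w[of k] abs_triangle_ineq4[of "x k" "y k"]
    by (simp add: add_divide_distrib[symmetric] divide_right_mono)
  show "0 \<le> \<bar>x k - y k\<bar> / w k" for k
    using w[of k] by simp
qed

lemma Metric_space_ell1:
  assumes w: "\<And>k. w k > 0"
  shows "Metric_space (ell1 w) (ell1_dist w)"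
proof
  note S = ell1_diff_summable[OF w]
  have nn: "0 \<le> \<bar>x k - y k\<bar> / w k" for x y :: "nat \<Rightarrow> real" and k
    using w[of k] by simp
  fix x y z
  show "0 \<le> ell1_dist w x y"
    unfolding ell1_dist_def ell1_norm_def by (rule infsum_nonneg) (rule nn)
  show "ell1_dist w x y = ell1_dist w y x"
    unfolding ell1_dist_def ell1_norm_def by (simp add: abs_minus_commute)
  show "ell1_dist w x y = 0 \<longleftrightarrow> x = y" if "x \<in> ell1 w" "y \<in> ell1 w"
  proof
    assume "ell1_dist w x y = 0"
    then have "\<bar>x k - y k\<bar> / w k = 0" for k
      unfolding ell1_dist_def ell1_norm_def
      by (intro nonneg_infsum_le_0D[where A = UNIV and f = "\<lambda>k. \<bar>x k - y k\<bar> / w k"])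
         (auto intro: S that nn)
    then have "x k = y k" for k
      using w[of k] less_imp_neq[OF w[of k]] by (metis abs_eq_0 divide_eq_0_iff eq_iff_diff_eq_0)
    then show "x = y" by auto
  qed (simp add: ell1_dist_def ell1_norm_def)
  show "ell1_dist w x z \<le> ell1_dist w x y + ell1_dist w y z"
    if "x \<in> ell1 w" "y \<in> ell1 w" "z \<in> ell1 w"
  proof -
    have "\<bar>x k - z k\<bar> / w k \<le> \<bar>x k - y k\<bar> / w k + \<bar>y k - z k\<bar> / w k" for k
      using w[of k] by (simp add: add_divide_distrib[symmetric] divide_right_mono)
    then show ?thesis
      unfolding ell1_dist_def ell1_norm_def
      using S[OF that(1,2)] S[OF that(2,3)] S[OF that(1,3)]
      by (subst infsum_add[symmetric]) (auto intro!: infsum_mono summable_on_add)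
  qed
qed

lemma topspace_ell1_topology:
  assumes "\<And>k. w k > 0"
  shows "topspace (ell1_topology w) = ell1 w"
  unfolding ell1_topology_def
  by (rule Metric_space.topspace_mtopology[OF Metric_space_ell1[OF assms]])

definition Gamma_converges ::
    "'a topology \<Rightarrow> (nat \<Rightarrow> 'a \<Rightarrow> ereal) \<Rightarrow> ('a \<Rightarrow> ereal) \<Rightarrow> bool" where
  "Gamma_converges X F G \<longleftrightarrow>
    (\<forall>x \<in> topspace X.
      (\<forall>xs. (\<forall>n. xs n \<in> topspace X) \<longrightarrow> limitin X xs x sequentially \<longrightarrow>
        G x \<le> liminf (\<lambda>n. F n (xs n))) \<and>
      (\<exists>xs. (\<forall>n. xs n \<in> topspace X) \<and> limitin X xs x sequentially \<and>
        G x \<ge> limsup (\<lambda>n. F n (xs n))))"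

definition equicoercive :: "'a topology \<Rightarrow> (nat \<Rightarrow> 'a \<Rightarrow> ereal) \<Rightarrow> bool" where
  "equicoercive X F \<longleftrightarrow>
    (\<forall>\<theta>::real. \<exists>K. compactin X K \<and> (\<forall>n. {x \<in> topspace X. F n x \<le> ereal \<theta>} \<subseteq> K))"

definition besov_gamma :: "nat \<Rightarrow> real \<Rightarrow> nat \<Rightarrow> real" where
  "besov_gamma d s k = real (Suc k) powr (1/2 - s / real d)"

definition besov_delta :: "nat \<Rightarrow> real \<Rightarrow> real \<Rightarrow> nat \<Rightarrow> real" where
  "besov_delta d s \<eta> k = real (Suc k) powr (3/2 + \<eta> - s / real d)"

definition laplace_measure :: "real \<Rightarrow> real measure" where
  "laplace_measure b = density lborel (\<lambda>u. ennreal (1 / (2 * b) * exp (- \<bar>u / b\<bar>)))"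

definition besov1_measure :: "nat \<Rightarrow> real \<Rightarrow> (nat \<Rightarrow> real) measure" where
  "besov1_measure d s = (\<Pi>\<^sub>M k\<in>UNIV. laplace_measure (besov_gamma d s k))"

definition besov1_OM :: "nat \<Rightarrow> real \<Rightarrow> (nat \<Rightarrow> real) \<Rightarrow> ereal" where
  "besov1_OM d s u =
    (if u \<in> ell1 (besov_gamma d s) then ereal (ell1_norm (besov_gamma d s) u) else \<infinity>)"

end

theory Submission
  imports Defs
begin

text \<open>The weights enter only through three facts. As \<open>s n\<close> tends to \<open>s \<infinity>\<close>, the weights \<open>\<gamma>\<close> of
  the \<open>n\<close>-th measure converge coordinatewise to those of the limit; for large \<open>n\<close> they lie
  below one fixed weight \<open>v\<close>, namely the one of smoothness \<open>s \<infinity> - d * \<eta> / 2\<close>; and the ratio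
  of \<open>v\<close> to \<open>\<delta>\<close> is summable, because it is a power of \<open>k + 1\<close> with exponent \<open>- 1 - \<eta> / 2\<close>.
  Everything before the Besov weights is about arbitrary weights with these properties.

  The summable ratio makes every box \<open>{h. \<bar>h k\<bar> \<le> M k}\<close> with \<open>M\<close> a multiple of \<open>v\<close> a Hilbert cube
  in \<open>ell1 \<delta>\<close>: tails are uniformly small on it, so the norm topology agrees there with the
  topology of coordinatewise convergence (\<open>continuous_map_id_coord_box\<close>), and Tychonoff's
  theorem makes it compact. A bound on an energy bounds each coordinate by a multiple of its
  weight, so all sublevel sets at one height lie in one box. This is equicoercivity.

  For the lower bound in the \<open>\<Gamma>\<close>-limit, the energy is the supremum of its partial sums, each of
  which depends continuously on finitely many coordinates and weights. For the upper bound,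
  multiply the coordinates of \<open>x\<close> by the ratio of the \<open>n\<close>-th weight to the limit weight: this
  keeps the energy exactly, so the whole sequence stays in one box, where its coordinatewise
  convergence to \<open>x\<close> is already norm convergence.

  Finally, the mean of \<open>\<bar>u\<bar>\<close> under the Laplace measure of scale \<open>b\<close> is \<open>b\<close>. The expected
  \<open>\<delta>\<close>-norm of a random sequence is therefore the sum of the ratios of \<open>\<gamma>\<close> to \<open>\<delta>\<close>; as this is
  finite, the norm is finite almost surely.\<close>

section \<open>The weighted norm as an extended-real functional\<close>

definition ell1_energy :: "(nat \<Rightarrow> real) \<Rightarrow> (nat \<Rightarrow> real) \<Rightarrow> ereal" where
  "ell1_energy w u = (if u \<in> ell1 w then ereal (ell1_norm w u) else \<infinity>)"

lemma besov1_OM_eq_energy: "besov1_OM d s = ell1_energy (besov_gamma d s)"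
  by (simp add: fun_eq_iff besov1_OM_def ell1_energy_def)

lemma ell1_iff_summable:
  assumes "\<And>k. w k > 0"
  shows "h \<in> ell1 w \<longleftrightarrow> summable (\<lambda>k. \<bar>h k\<bar> / w k)"
  using assms by (simp add: ell1_def abs_divide less_imp_le summable_on_UNIV_nonneg_real_iff)

lemma ell1_norm_eq_suminf:
  assumes "\<And>k. w k > 0" "h \<in> ell1 w"
  shows "ell1_norm w h = (\<Sum>k. \<bar>h k\<bar> / w k)"
  unfolding ell1_norm_def
  using has_sum_imp_sums[OF has_sum_infsum[OF ell1_summable[of w h]]] assms
  by (simp add: sums_iff)

text \<open>The energy is the supremum of the partial sums. Stated as a criterion for upper bounds, this
  covers sequences outside \<open>ell1 w\<close> as well and gives lower semicontinuity directly.\<close>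

lemma ell1_energy_le_iff_partial_sums:
  assumes w: "\<And>k. w k > 0"
  shows "ell1_energy w u \<le> c \<longleftrightarrow> (\<forall>N. ereal (\<Sum>k<N. \<bar>u k\<bar> / w k) \<le> c)"
proof
  have nn: "0 \<le> \<bar>u k\<bar> / w k" for k using w[of k] by simp
  show "\<forall>N. ereal (\<Sum>k<N. \<bar>u k\<bar> / w k) \<le> c" if le: "ell1_energy w u \<le> c"
  proof
    fix N
    have "ereal (\<Sum>k<N. \<bar>u k\<bar> / w k) \<le> ell1_energy w u"
      using w nn by (auto simp: ell1_energy_def ell1_norm_eq_suminf ell1_iff_summable intro!: sum_le_suminf)
    with le show "ereal (\<Sum>k<N. \<bar>u k\<bar> / w k) \<le> c" by (rule order_trans[rotated])
  qed
  assume bound: "\<forall>N. ereal (\<Sum>k<N. \<bar>u k\<bar> / w k) \<le> c"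
  show "ell1_energy w u \<le> c"
  proof (cases c)
    case (real r)
    with bound have r: "(\<Sum>k<N. \<bar>u k\<bar> / w k) \<le> r" for N by simp
    then have "summable (\<lambda>k. \<bar>u k\<bar> / w k)"
      using nn by (intro summableI_nonneg_bounded)
    with r show ?thesis
      using w by (simp add: real ell1_energy_def ell1_norm_eq_suminf ell1_iff_summable suminf_le_const)
  next
    case MInf
    with bound[rule_format, of 0] show ?thesis by simp
  qed simp
qed

lemma coordinate_le_ell1_energy:
  assumes w: "\<And>k. w k > 0" and le: "ell1_energy w u \<le> ereal c"
  shows "\<bar>u k\<bar> \<le> c * w k"
proof -
  have "\<bar>u k\<bar> / w k \<le> (\<Sum>i<Suc k. \<bar>u i\<bar> / w i)"
    using w by (intro member_le_sum) (auto simp: less_imp_le)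
  also have "\<dots> \<le> c"
    using iffD1[OF ell1_energy_le_iff_partial_sums[OF w] le, rule_format, of "Suc k"]
    by (simp only: ereal_less_eq)
  finally show ?thesis using w[of k] by (simp add: field_simps)
qed

section \<open>Boxes with summable side ratios are Hilbert cubes\<close>

definition coord_box :: "(nat \<Rightarrow> real) \<Rightarrow> (nat \<Rightarrow> real) set" where
  "coord_box M = {h. \<forall>k. \<bar>h k\<bar> \<le> M k}"

lemma coord_box_subset_ell1:
  assumes w: "\<And>k. w k > 0" and M: "summable (\<lambda>k. M k / w k)"
  shows "coord_box M \<subseteq> ell1 w"
proof
  fix h assume "h \<in> coord_box M"
  then have "\<bar>h k\<bar> / w k \<le> M k / w k" for k
    using w[of k] by (simp add: coord_box_def divide_right_mono)
  then have "summable (\<lambda>k. \<bar>h k\<bar> / w k)"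
    using w by (intro summable_comparison_test'[OF M, of 0]) (simp add: less_imp_le)
  then show "h \<in> ell1 w" using ell1_iff_summable[OF w] by simp
qed

text \<open>Compactness here refers to the product topology, which is the topology of the function type;
  it is Tychonoff's theorem.\<close>

lemma compact_coord_box: "compact (coord_box M)"
proof -
  have "\<bar>a\<bar> \<le> b \<longleftrightarrow> a \<in> {- b..b}" for a b :: real by auto
  then have "coord_box M = (\<Pi>\<^sub>E k\<in>UNIV. {- M k..M k})"
    by (simp only: coord_box_def PiE_UNIV_domain Pi_def) simp
  moreover have "compactin (product_topology (\<lambda>_. euclidean) UNIV) (\<Pi>\<^sub>E k\<in>UNIV. {- M k..M k})"
    by (simp add: compactin_PiE)
  ultimately show ?thesis by (simp add: euclidean_product_topology)
qed

text \<open>The tail of the norm distance between two points of the box is at most twice the tail of the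
  summable series, whatever the points are. What remains is a finite sum, which is
  continuous for the product topology.\<close>

lemma continuous_map_id_coord_box:
  assumes w: "\<And>k. w k > 0" and M: "summable (\<lambda>k. M k / w k)"
  shows "continuous_map (top_of_set (coord_box M)) (ell1_topology w) id"
proof -
  interpret Metric_space "ell1 w" "ell1_dist w" by (rule Metric_space_ell1[OF w])
  have sub: "coord_box M \<subseteq> ell1 w" by (rule coord_box_subset_ell1[OF w M])
  show ?thesis
    unfolding ell1_topology_def continuous_map_to_metric
  proof (intro ballI allI impI)
    fix x :: "nat \<Rightarrow> real" and e :: real
    assume "x \<in> topspace (top_of_set (coord_box M))" and e: "e > 0"
    then have x: "x \<in> coord_box M" by simp
    have "\<exists>N. \<forall>n\<ge>N. norm (\<Sum>i. M (i + n) / w (i + n)) < e / 4"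
      using suminf_exist_split[OF _ M, of "e / 4"] e by auto
    then obtain N where N: "(\<Sum>k. M (k + N) / w (k + N)) < e / 4"
      by (metis order_refl real_norm_def abs_ge_self le_less_trans)
    \<comment> \<open>Tails contribute at most \<open>2 * (e / 4)\<close>, which leaves \<open>e / 2\<close> for the first \<open>N\<close> coordinates.\<close>
    define head where "head y = (\<Sum>k<N. \<bar>y k - x k\<bar> / w k)" for y :: "nat \<Rightarrow> real"
    define U where "U = coord_box M \<inter> {y. head y < e / 2}"
    have "open {y. head y < e / 2}"
      unfolding head_def using w by (intro open_Collect_less continuous_intros) (auto simp: less_imp_neq[symmetric])
    then have "openin (top_of_set (coord_box M)) U"
      unfolding U_def by (rule openin_open_Int)
    moreover have "x \<in> U" using x e by (simp add: U_def head_def)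
    moreover have "id y \<in> mball (id x) e" if "y \<in> U" for y
    proof -
      have y: "y \<in> coord_box M" "head y < e / 2" using that by (auto simp: U_def)
      have xy: "(\<lambda>k. y k - x k) \<in> ell1 w"
        using ell1_diff_summable[where w = w and x = y and y = x, OF w] x y sub w
        by (auto simp: ell1_def abs_divide less_imp_le)
      have S: "summable (\<lambda>k. \<bar>y k - x k\<bar> / w k)"
        using xy ell1_iff_summable[OF w] by simp
      have "\<bar>y k - x k\<bar> / w k \<le> 2 * (M k / w k)" for k
      proof -
        have "\<bar>y k - x k\<bar> \<le> 2 * M k"
          using x y abs_triangle_ineq4[of "y k" "x k"]
          by (auto simp: coord_box_def dest!: spec[of _ k])
        then show ?thesis using w[of k] by (simp add: field_simps)
      qed
      then have "(\<Sum>k. \<bar>y (k + N) - x (k + N)\<bar> / w (k + N)) \<le> (\<Sum>k. 2 * (M (k + N) / w (k + N)))"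
        using summable_ignore_initial_segment[OF S, of N]
          summable_mult[OF summable_ignore_initial_segment[OF M, of N], of 2]
        by (intro suminf_le)
      also have "\<dots> = 2 * (\<Sum>k. M (k + N) / w (k + N))"
        by (rule suminf_mult[OF summable_ignore_initial_segment[OF M]])
      finally have tail: "(\<Sum>k. \<bar>y (k + N) - x (k + N)\<bar> / w (k + N)) < e / 2" using N by simp
      have "ell1_dist w y x = (\<Sum>k. \<bar>y (k + N) - x (k + N)\<bar> / w (k + N)) + head y"
        unfolding ell1_dist_def ell1_norm_eq_suminf[OF w xy] head_def
        by (rule suminf_split_initial_segment[OF S])
      then have "ell1_dist w x y < e" using tail y(2) commute by simp
      then show ?thesis using x y sub by auto
    qed
    ultimately show "\<exists>U. openin (top_of_set (coord_box M)) U \<and> x \<in> U \<and> (\<forall>y\<in>U. id y \<in> mball (id x) e)"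
      by blast
  qed
qed

lemma compactin_coord_box:
  assumes "\<And>k. w k > 0" "summable (\<lambda>k. M k / w k)"
  shows "compactin (ell1_topology w) (coord_box M)"
  using image_compactin[OF _ continuous_map_id_coord_box[OF assms]] compact_coord_box
  by (simp add: compactin_subtopology)

lemma limitin_ell1_of_coordinatewise:
  assumes w: "\<And>k. w k > 0" and M: "summable (\<lambda>k. M k / w k)"
    and box: "\<And>n. xs n \<in> coord_box M" "x \<in> coord_box M"
    and lim: "\<And>k. (\<lambda>n. xs n k) \<longlonglongrightarrow> x k"
  shows "limitin (ell1_topology w) xs x sequentially"
proof -
  have "limitin (product_topology (\<lambda>_. euclidean) UNIV) xs x sequentially"
    using lim by (simp add: limitin_componentwise)
  then have "limitin (top_of_set (coord_box M)) xs x sequentially"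
    using box by (simp add: limitin_subtopology euclidean_product_topology)
  from continuous_map_limit[OF continuous_map_id_coord_box[OF w M] this] show ?thesis by simp
qed

lemma coordinatewise_of_limitin_ell1:
  assumes w: "\<And>k. w k > 0" and lim: "limitin (ell1_topology w) xs x sequentially"
  shows "(\<lambda>n. xs n k) \<longlonglongrightarrow> x k"
proof -
  interpret Metric_space "ell1 w" "ell1_dist w" by (rule Metric_space_ell1[OF w])
  have x: "x \<in> ell1 w" and ev: "\<forall>\<^sub>F n in sequentially. xs n \<in> ell1 w"
    and d: "(\<lambda>n. ell1_dist w (xs n) x) \<longlonglongrightarrow> 0"
    using lim by (auto simp: ell1_topology_def limitin_metric_dist_null)
  have "\<bar>y k - x k\<bar> \<le> ell1_dist w y x * w k" if "y \<in> ell1 w" for y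
  proof -
    have "(\<lambda>k. y k - x k) \<in> ell1 w"
      using ell1_diff_summable[OF w that x] w by (simp add: ell1_def abs_divide less_imp_le)
    then have "ell1_energy w (\<lambda>k. y k - x k) \<le> ereal (ell1_dist w y x)"
      by (simp add: ell1_energy_def ell1_dist_def)
    from coordinate_le_ell1_energy[OF w this] show ?thesis .
  qed
  then have "\<forall>\<^sub>F n in sequentially. norm (xs n k - x k) \<le> ell1_dist w (xs n) x * w k"
    using ev by (auto elim: eventually_mono)
  moreover have "(\<lambda>n. ell1_dist w (xs n) x * w k) \<longlonglongrightarrow> 0"
    using tendsto_mult_right[OF d, of "w k"] by simp
  ultimately have "(\<lambda>n. xs n k - x k) \<longlonglongrightarrow> 0" by (rule Lim_null_comparison)
  then show ?thesis by (simp add: LIM_zero_iff)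
qed

section \<open>Equicoercivity and \<open>\<Gamma>\<close>-convergence for converging weights\<close>

text \<open>The common bound \<open>v\<close> on the weights puts the sublevel sets of height \<open>\<theta>\<close> of all the
  functionals into the box with half-sides \<open>\<bar>\<theta>\<bar> * v k\<close>. The absolute value covers \<open>\<theta> < 0\<close>,
  where the sublevel sets are empty.\<close>

lemma equicoercive_ell1_energy:
  assumes \<delta>: "\<And>k. \<delta> k > 0" and w: "\<And>n k. w n k > 0"
    and v: "\<And>n k. w n k \<le> v k" and sum: "summable (\<lambda>k. v k / \<delta> k)"
  shows "equicoercive (ell1_topology \<delta>) (\<lambda>n. ell1_energy (w n))"
  unfolding equicoercive_def
proof (intro allI exI conjI)
  fix \<theta> :: real and n
  have "summable (\<lambda>k. \<bar>\<theta>\<bar> * v k / \<delta> k)"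
    using summable_mult[OF sum, of "\<bar>\<theta>\<bar>"] by simp
  with \<delta> show "compactin (ell1_topology \<delta>) (coord_box (\<lambda>k. \<bar>\<theta>\<bar> * v k))"
    by (rule compactin_coord_box)
  show "{x \<in> topspace (ell1_topology \<delta>). ell1_energy (w n) x \<le> ereal \<theta>}
      \<subseteq> coord_box (\<lambda>k. \<bar>\<theta>\<bar> * v k)"
  proof (clarsimp simp: coord_box_def)
    fix x k assume "ell1_energy (w n) x \<le> ereal \<theta>"
    then have "\<bar>x k\<bar> \<le> \<theta> * w n k" by (rule coordinate_le_ell1_energy[OF w])
    also have "\<dots> \<le> \<bar>\<theta>\<bar> * v k"
      using w[of n k] v[of n k] by (intro mult_mono) auto
    finally show "\<bar>x k\<bar> \<le> \<bar>\<theta>\<bar> * v k" .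
  qed
qed

text \<open>Each partial sum of the limit is a limit of partial sums that are bounded by the
  energies, so the lower bound already holds along coordinatewise convergent sequences.\<close>

lemma ell1_energy_liminf:
  assumes w: "\<And>n k. w n k > 0" and w': "\<And>k. w' k > 0"
    and conv: "\<And>k. (\<lambda>n. w n k) \<longlonglongrightarrow> w' k" and lim: "\<And>k. (\<lambda>n. xs n k) \<longlonglongrightarrow> x k"
  shows "ell1_energy w' x \<le> liminf (\<lambda>n. ell1_energy (w n) (xs n))"
  unfolding ell1_energy_le_iff_partial_sums[OF w']
proof
  fix N
  have "(\<lambda>n. \<Sum>k<N. \<bar>xs n k\<bar> / w n k) \<longlonglongrightarrow> (\<Sum>k<N. \<bar>x k\<bar> / w' k)"
    using w' by (intro tendsto_intros conv lim) (simp add: less_imp_neq[symmetric])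
  then have "liminf (\<lambda>n. ereal (\<Sum>k<N. \<bar>xs n k\<bar> / w n k)) = ereal (\<Sum>k<N. \<bar>x k\<bar> / w' k)"
    by (intro lim_imp_Liminf) auto
  moreover have "liminf (\<lambda>n. ereal (\<Sum>k<N. \<bar>xs n k\<bar> / w n k))
      \<le> liminf (\<lambda>n. ell1_energy (w n) (xs n))"
    using iffD1[OF ell1_energy_le_iff_partial_sums[of "w n" for n, OF w] order_refl]
    by (intro Liminf_mono always_eventually) blast
  ultimately show "ereal (\<Sum>k<N. \<bar>x k\<bar> / w' k) \<le> liminf (\<lambda>n. ell1_energy (w n) (xs n))"
    by simp
qed

text \<open>Rescaling coordinates by ratios of weights is an isometry between the weighted spaces. It
  supplies the recovery sequence below, with no error term to control.\<close>

lemma ell1_energy_rescale: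
  assumes "\<And>k. w k > 0" "\<And>k. w' k > 0"
  shows "ell1_energy w (\<lambda>k. x k * (w k / w' k)) = ell1_energy w' x"
proof -
  have "\<bar>x k * (w k / w' k)\<bar> / w k = \<bar>x k\<bar> / w' k" for k
    using assms(1)[of k] assms(2)[of k] by (simp add: abs_mult)
  then show ?thesis
    using assms by (simp add: ell1_energy_def ell1_iff_summable ell1_norm_def)
qed

lemma Gamma_converges_ell1_energy:
  assumes \<delta>: "\<And>k. \<delta> k > 0" and w: "\<And>n k. w n k > 0" and w': "\<And>k. w' k > 0"
    and v: "\<And>n k. w n k \<le> v k" and sum: "summable (\<lambda>k. v k / \<delta> k)"
    and conv: "\<And>k. (\<lambda>n. w n k) \<longlonglongrightarrow> w' k"
  shows "Gamma_converges (ell1_topology \<delta>) (\<lambda>n. ell1_energy (w n)) (ell1_energy w')"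
  unfolding Gamma_converges_def
proof (intro ballI conjI allI impI)
  fix x xs assume "limitin (ell1_topology \<delta>) xs x sequentially"
  then show "ell1_energy w' x \<le> liminf (\<lambda>n. ell1_energy (w n) (xs n))"
    by (intro ell1_energy_liminf w w' conv coordinatewise_of_limitin_ell1[OF \<delta>])
next
  fix x assume x: "x \<in> topspace (ell1_topology \<delta>)"
  show "\<exists>xs. (\<forall>n. xs n \<in> topspace (ell1_topology \<delta>)) \<and>
      limitin (ell1_topology \<delta>) xs x sequentially \<and>
      limsup (\<lambda>n. ell1_energy (w n) (xs n)) \<le> ell1_energy w' x"
  proof (cases "x \<in> ell1 w'")
    case False
    then have "ell1_energy w' x = \<infinity>" by (simp add: ell1_energy_def)
    with x show ?thesis by (intro exI[of _ "\<lambda>_. x"]) simp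
  next
    case True
    define c where "c = ell1_norm w' x"
    have c: "ell1_energy w' x = ereal c" using True by (simp add: ell1_energy_def c_def)
    \<comment> \<open>The isometric images of \<open>x\<close> form the recovery sequence; their common energy \<open>c\<close> confines them,
      and \<open>x\<close> itself, to the box with half-sides \<open>c * v k\<close>.\<close>
    define xs where "xs n k = x k * (w n k / w' k)" for n k
    have energy: "ell1_energy (w n) (xs n) = ereal c" for n
      using ell1_energy_rescale[of "w n" w' x, OF w w'] by (simp only: xs_def[abs_def] c)
    have "0 \<le> c * w' 0"
      using coordinate_le_ell1_energy[where w = w' and u = x and c = c and k = 0, OF w'] c
        abs_ge_zero[of "x 0"] by simp
    then have c0: "0 \<le> c" using w'[of 0] by (simp add: zero_le_mult_iff)
    have v': "w' k \<le> v k" for k by (rule LIMSEQ_le_const2[OF conv]) (use v in auto)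
    have in_box: "y \<in> coord_box (\<lambda>k. c * v k)"
      if "\<And>k. u k > 0" "\<And>k. u k \<le> v k" "ell1_energy u y = ereal c" for u y
      using coordinate_le_ell1_energy[of u y c] that mult_left_mono[OF that(2) c0]
      by (fastforce simp: coord_box_def intro: order_trans)
    have S: "summable (\<lambda>k. c * v k / \<delta> k)"
      using summable_mult[OF sum, of c] by simp
    have xs: "xs n \<in> coord_box (\<lambda>k. c * v k)" for n
      by (rule in_box[OF w v energy])
    have "(\<lambda>n. xs n k) \<longlonglongrightarrow> x k" for k
    proof -
      have "(\<lambda>n. xs n k) \<longlonglongrightarrow> x k * (w' k / w' k)"
        unfolding xs_def using w'[of k] by (intro tendsto_intros conv) simp
      then show ?thesis using w'[of k] by simp
    qed
    then have "limitin (ell1_topology \<delta>) xs x sequentially"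
      by (rule limitin_ell1_of_coordinatewise[OF \<delta> S xs in_box[OF w' v' c]])
    moreover have "xs n \<in> topspace (ell1_topology \<delta>)" for n
      using xs coord_box_subset_ell1[OF \<delta> S] by (auto simp: topspace_ell1_topology[OF \<delta>])
    ultimately show ?thesis
      by (intro exI[of _ xs]) (simp add: energy c Limsup_const)
  qed
qed

section \<open>Concentration of Laplace products on weighted spaces\<close>

lemma sets_laplace_measure [measurable_cong, simp]: "sets (laplace_measure b) = sets borel"
  by (simp add: laplace_measure_def)

lemma space_laplace_measure [simp]: "space (laplace_measure b) = UNIV"
  by (simp add: laplace_measure_def)

text \<open>Away from 0 the Laplace density is the average of an exponential density and its reflection,
  so these moments are the known moments of the exponential distribution. Order 0 gives the
  total mass, order 1 the mean absolute value.\<close>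

lemma nn_integral_laplace_abs_moment:
  assumes b: "b > 0"
  shows "(\<integral>\<^sup>+ u. ennreal (\<bar>u\<bar> ^ i) \<partial>laplace_measure b) = ennreal (fact i * b ^ i)"
proof -
  define g where "g u = ennreal (1 / 2 * (exponential_density (1 / b) u * u ^ i))" for u :: real
  have g_meas [measurable]: "g \<in> borel_measurable borel" unfolding g_def by measurable
  have "(\<integral>\<^sup>+ u. g u \<partial>lborel)
      = (\<integral>\<^sup>+ u. ennreal (1 / 2) * ennreal (exponential_density (1 / b) u * u ^ i) \<partial>lborel)"
    unfolding g_def by (intro nn_integral_cong ennreal_mult') simp
  also have "\<dots> = ennreal (1 / 2) * (\<integral>\<^sup>+ u. ennreal (exponential_density (1 / b) u * u ^ i) \<partial>lborel)"
    by (rule nn_integral_cmult) measurable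
  also have "\<dots> = ennreal (1 / 2) * ennreal (fact i * b ^ i)"
    using nn_integral_erlang_ith_moment[of "1 / b" 0 i] b by (simp add: power_one_over)
  also have "\<dots> = ennreal (1 / 2 * (fact i * b ^ i))"
    by (rule ennreal_mult'[symmetric]) simp
  finally have g_int: "(\<integral>\<^sup>+ u. g u \<partial>lborel) = ennreal (1 / 2 * (fact i * b ^ i))" .
  have g_refl: "(\<integral>\<^sup>+ u. g (- u) \<partial>lborel) = (\<integral>\<^sup>+ u. g u \<partial>lborel)"
    using nn_integral_real_affine[of g "-1" 0] by simp
  have "(\<integral>\<^sup>+ u. ennreal (\<bar>u\<bar> ^ i) \<partial>laplace_measure b)
      = (\<integral>\<^sup>+ u. ennreal (1 / (2 * b) * exp (- \<bar>u / b\<bar>)) * ennreal (\<bar>u\<bar> ^ i) \<partial>lborel)"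
    unfolding laplace_measure_def by (rule nn_integral_density) auto
  also have "\<dots> = (\<integral>\<^sup>+ u. g u + g (- u) \<partial>lborel)"
  proof (rule nn_integral_cong_AE)
    show "AE u in lborel. ennreal (1 / (2 * b) * exp (- \<bar>u / b\<bar>)) * ennreal (\<bar>u\<bar> ^ i)
        = g u + g (- u)"
      using AE_lborel_singleton[of "0 :: real"]
    proof eventually_elim
      case (elim u)
      then consider "u > 0" | "u < 0" by linarith
      then show ?case
        using b by cases (simp_all add: g_def exponential_density_def ennreal_mult'[symmetric] field_simps)
    qed
  qed
  also have "\<dots> = ennreal (1 / 2 * (fact i * b ^ i)) + ennreal (1 / 2 * (fact i * b ^ i))"
    by (subst nn_integral_add) (simp_all only: g_refl g_int, measurable)
  also have "\<dots> = ennreal (fact i * b ^ i)"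
    using b by (subst ennreal_plus[symmetric]) auto
  finally show ?thesis .
qed

lemma prob_space_laplace_measure:
  assumes "b > 0"
  shows "prob_space (laplace_measure b)"
proof
  show "emeasure (laplace_measure b) (space (laplace_measure b)) = 1"
    using nn_integral_laplace_abs_moment[OF assms, of 0] by simp
qed

text \<open>The series of \<open>\<bar>h k\<bar> / w k\<close>, taken as an extended nonnegative random variable, has mean equal to
  the sum of \<open>b k / w k\<close>. As this is finite, so is the series almost surely, and finiteness of
  the series is membership in \<open>ell1 w\<close>; the same description shows that \<open>ell1 w\<close> is measurable.\<close>

lemma laplace_product_concentrated_on_ell1:
  assumes b: "\<And>k. b k > 0" and w: "\<And>k. w k > 0" and sum: "summable (\<lambda>k. b k / w k)"
  shows "emeasure (\<Pi>\<^sub>M k\<in>UNIV. laplace_measure (b k)) (ell1 w) = 1"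
proof -
  let ?P = "\<Pi>\<^sub>M k\<in>UNIV. laplace_measure (b k)"
  have prob: "prob_space (laplace_measure (b k))" for k
    by (rule prob_space_laplace_measure[OF b])
  interpret prob_space ?P by (rule prob_space_PiM) (rule prob)
  have space: "space ?P = UNIV" by (simp add: space_PiM)
  have coord [measurable]: "(\<lambda>h. h k) \<in> borel_measurable ?P" for k
    using measurable_component_singleton[of k UNIV "\<lambda>k. laplace_measure (b k)"]
    by (simp cong: measurable_cong_sets)
  have summand: "(\<lambda>h. ennreal (\<bar>h k\<bar> / w k)) \<in> borel_measurable ?P" for k by measurable
  define T where "T h = (\<Sum>k. ennreal (\<bar>h k\<bar> / w k))" for h :: "nat \<Rightarrow> real"
  have T [measurable]: "T \<in> borel_measurable ?P" unfolding T_def by measurable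
  have mean: "(\<integral>\<^sup>+ h. ennreal (\<bar>h k\<bar> / w k) \<partial>?P) = ennreal (b k / w k)" for k
  proof -
    have meas: "f \<in> borel_measurable (laplace_measure (b k))" if "f \<in> borel_measurable borel"
      for f :: "real \<Rightarrow> ennreal"
      unfolding measurable_cong_sets[OF sets_laplace_measure refl] by (rule that)
    have "(\<integral>\<^sup>+ h. ennreal (\<bar>h k\<bar> / w k) \<partial>?P)
        = (\<integral>\<^sup>+ u. ennreal (\<bar>u\<bar> / w k) \<partial>distr ?P (laplace_measure (b k)) (\<lambda>h. h k))"
      by (rule nn_integral_distr[symmetric, OF measurable_component_singleton[OF UNIV_I]])
        (subst measurable_cong_sets[OF sets_distr refl], rule meas, measurable)
    also have "\<dots> = (\<integral>\<^sup>+ u. ennreal (\<bar>u\<bar> / w k) \<partial>laplace_measure (b k))"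
      using distr_PiM_component[of UNIV "\<lambda>k. laplace_measure (b k)" k] prob by simp
    also have "\<dots> = (\<integral>\<^sup>+ u. ennreal (1 / w k) * ennreal (\<bar>u\<bar> ^ 1) \<partial>laplace_measure (b k))"
      using w[of k] by (simp add: ennreal_mult'[symmetric])
    also have "\<dots> = ennreal (1 / w k) * (\<integral>\<^sup>+ u. ennreal (\<bar>u\<bar> ^ 1) \<partial>laplace_measure (b k))"
      by (intro nn_integral_cmult meas) measurable
    also have "\<dots> = ennreal (b k / w k)"
      unfolding nn_integral_laplace_abs_moment[OF b]
      using w[of k] b[of k] by (simp add: ennreal_mult'[symmetric])
    finally show ?thesis .
  qed
  have "(\<integral>\<^sup>+ h. T h \<partial>?P) = (\<Sum>k. \<integral>\<^sup>+ h. ennreal (\<bar>h k\<bar> / w k) \<partial>?P)"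
    unfolding T_def by (rule nn_integral_suminf) (rule summand)
  also have "\<dots> = (\<Sum>k. ennreal (b k / w k))" by (simp only: mean)
  also have "\<dots> \<noteq> \<infinity>"
    unfolding infinity_ennreal_def using b w
    by (intro ennreal_suminf_neq_top[OF sum] divide_nonneg_pos less_imp_le)
  finally have AE: "AE h in ?P. T h \<noteq> \<infinity>" by (rule nn_integral_noteq_infinite[OF T])
  have "h \<in> ell1 w \<longleftrightarrow> T h \<noteq> \<infinity>" for h
  proof -
    have nn: "0 \<le> \<bar>h k\<bar> / w k" for k using w[of k] by simp
    show ?thesis
      unfolding T_def ell1_iff_summable[OF w] infinity_ennreal_def
      by (rule iffI, erule ennreal_suminf_neq_top, rule nn, rule summable_suminf_not_top, rule nn)
  qed
  then have eq: "ell1 w = {h \<in> space ?P. T h \<noteq> \<infinity>}" unfolding space by blast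
  have "ell1 w \<in> sets ?P" unfolding eq by measurable
  moreover have "AE h in ?P. h \<in> ell1 w" using AE unfolding eq space by simp
  ultimately show ?thesis by (rule emeasure_eq_1_AE)
qed

section \<open>Besov weights\<close>

lemma summable_Suc_powr:
  assumes "a < -1"
  shows "summable (\<lambda>k. real (Suc k) powr a)"
  using assms by (simp add: summable_real_powr_iff summable_Suc_iff[of "\<lambda>n. real n powr a"] del: of_nat_Suc)

lemma besov_gamma_pos: "besov_gamma d s k > 0"
  and besov_delta_pos: "besov_delta d s \<eta> k > 0"
  by (simp_all add: besov_gamma_def besov_delta_def)

lemma besov_gamma_antimono:
  assumes "s' \<le> s"
  shows "besov_gamma d s k \<le> besov_gamma d s' k"
  unfolding besov_gamma_def using assms by (intro powr_mono) (auto simp: divide_right_mono)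

text \<open>The ratio is a power of \<open>k + 1\<close> with exponent \<open>- 1 - \<eta> + (s - s') / d\<close>; the condition on \<open>s'\<close>
  says that this exponent is below \<open>- 1\<close>.\<close>

lemma summable_besov_gamma_over_delta:
  assumes "d \<ge> 1" "s - real d * \<eta> < s'"
  shows "summable (\<lambda>k. besov_gamma d s' k / besov_delta d s \<eta> k)"
proof -
  have "s / real d - \<eta> < s' / real d"
    using assms divide_strict_right_mono[of "s - real d * \<eta>" s' "real d"] by (simp add: diff_divide_distrib)
  then have "summable (\<lambda>k. real (Suc k) powr ((1/2 - s' / real d) - (3/2 + \<eta> - s / real d)))"
    by (intro summable_Suc_powr) simp
  then show ?thesis by (simp only: besov_gamma_def besov_delta_def powr_diff[symmetric])
qed

section \<open>Besov-1 measures with converging smoothness\<close>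

theorem theorem5p13:
  fixes d :: nat and s :: "enat \<Rightarrow> real" and \<eta> :: real
  assumes "d \<ge> 1"
    and "\<And>n. n \<ge> 1 \<Longrightarrow> s n / real d + 1/2 > 0"
    and "\<eta> > 0"
    and "(\<lambda>n::nat. s (enat n)) \<longlonglongrightarrow> s \<infinity>"
  shows "\<exists>n0::nat. n0 \<ge> 1 \<and>
    (\<forall>n \<ge> enat n0. emeasure (besov1_measure d (s n)) (ell1 (besov_delta d (s \<infinity>) \<eta>)) = 1) \<and>
    equicoercive (ell1_topology (besov_delta d (s \<infinity>) \<eta>))
      (\<lambda>m. besov1_OM d (s (enat (n0 + m)))) \<and>
    Gamma_converges (ell1_topology (besov_delta d (s \<infinity>) \<eta>))
      (\<lambda>m. besov1_OM d (s (enat (n0 + m)))) (besov1_OM d (s \<infinity>))"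
proof -
  \<comment> \<open>\<open>r\<close> is halfway between \<open>s \<infinity>\<close> and \<open>s \<infinity> - d * \<eta>\<close>, where summability against \<open>\<delta>\<close> is lost:
    it lies below \<open>s n\<close> for large \<open>n\<close>, and its weight serves as the common bound \<open>v\<close>.\<close>
  define r where "r = s \<infinity> - real d * \<eta> / 2"
  have pos: "real d * \<eta> > 0" using assms(1,3) by simp
  have sum: "summable (\<lambda>k. besov_gamma d r k / besov_delta d (s \<infinity>) \<eta> k)"
    using pos by (intro summable_besov_gamma_over_delta assms(1)) (simp add: r_def mult.commute)
  have "\<forall>\<^sub>F n in sequentially. r < s (enat n)"
    using pos by (intro order_tendstoD(1)[OF assms(4)]) (simp add: r_def)
  then obtain n1 where n1: "\<And>n. n \<ge> n1 \<Longrightarrow> r < s (enat n)"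
    unfolding eventually_sequentially by blast
  define n0 where "n0 = max 1 n1"
  have r_less: "r < s n" if "enat n0 \<le> n" for n
    using that n1 pos by (cases n) (auto simp: n0_def r_def)
  have dom: "besov_gamma d (s (enat (n0 + m))) k \<le> besov_gamma d r k" for m k
    by (intro besov_gamma_antimono less_imp_le[OF r_less]) simp
  have conv: "(\<lambda>m. besov_gamma d (s (enat (n0 + m))) k) \<longlonglongrightarrow> besov_gamma d (s \<infinity>) k" for k
  proof -
    have "(\<lambda>m. s (enat (n0 + m))) \<longlonglongrightarrow> s \<infinity>"
      using LIMSEQ_ignore_initial_segment[OF assms(4), of n0] by (simp add: add.commute)
    then show ?thesis
      unfolding besov_gamma_def using assms(1) by (intro tendsto_intros) auto
  qed
  have "emeasure (besov1_measure d (s n)) (ell1 (besov_delta d (s \<infinity>) \<eta>)) = 1"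
    if "enat n0 \<le> n" for n
    unfolding besov1_measure_def
    using r_less[OF that] pos
    by (intro laplace_product_concentrated_on_ell1 besov_gamma_pos besov_delta_pos
        summable_besov_gamma_over_delta assms(1)) (simp add: r_def mult.commute)
  moreover have "equicoercive (ell1_topology (besov_delta d (s \<infinity>) \<eta>))
      (\<lambda>m. besov1_OM d (s (enat (n0 + m))))"
    unfolding besov1_OM_eq_energy
    by (rule equicoercive_ell1_energy[OF besov_delta_pos besov_gamma_pos dom sum])
  moreover have "Gamma_converges (ell1_topology (besov_delta d (s \<infinity>) \<eta>))
      (\<lambda>m. besov1_OM d (s (enat (n0 + m)))) (besov1_OM d (s \<infinity>))"
    unfolding besov1_OM_eq_energy
    by (rule Gamma_converges_ell1_energy
        [OF besov_delta_pos besov_gamma_pos besov_gamma_pos dom sum conv])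
  ultimately show ?thesis by (intro exI[of _ n0]) (simp add: n0_def)
qed

end
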